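(* Let $n\ge1$ and let $C_n^{\mathrm{eucl}}$ be the set of $n$ equidistant points on the unit circle in $\mathbb{R}^2$ with the Euclidean metric. Then for $t\in(0,\infty)$ $$|tC_n^{\mathrm{eucl}}|_{\mathrm{Rips}}=\sum_{\substack{r\mid n,\ r\text{ odd}\\ r\neq n}}\frac nr\bigl(e^{-\delta_rt}-e^{-\delta_{r,n}t}\bigr)+e^{-\delta_nt},$$ where the sum is over positive odd divisors $r\neq n$ of $n$ and $$\delta_r=\mathrm{diam}(C_r^{\mathrm{eucl}})=2\sin\left(\pi\frac{\lfloor r/2\rfloor}{r}\right),\qquad \delta_{r,n}=2\sin\left(\pi\left(\frac1n+\frac{\lfloor r/2\rfloor}{r}\right)\right).$$
   Context: For a finite metric space $X$, the Rips magnitude function $|tX|_{\mathrm{Rips}}$ is the persistent magnitude function of the persistent homology of its Vietoris–Rips complex; equivalently, it is given for $t\in(0,\infty)$ by $|tX|_{\mathrm{Rips}}=\sum_{\emptyset\ne A\subseteq X}(-1)^{\#A-1}e^{-\mathrm{diam}(A)t}$. *)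

theory Defs
  imports "HOL-Analysis.Analysis"
begin

(* For a finite metric space X the persistent magnitude of the persistent homology of the
   Vietoris-Rips filtration of X equals the alternating sum below over the simplices of that
   filtration, the simplex A being born at parameter diam A; this sum is taken as the definition. *)
definition rips_magnitude :: "'a::metric_space set \<Rightarrow> real \<Rightarrow> real" where
  "rips_magnitude X t =
     (\<Sum>A | A \<noteq> {} \<and> A \<subseteq> X. (-1) ^ (card A - 1) * exp (- diameter A * t))"

(* The set is only determined up to rotation by being n equidistant points; the representative
   containing (1, 0) is used. *)
definition eucl_cycle :: "nat \<Rightarrow> (real ^ 2) set" where
  "eucl_cycle n =
     (\<lambda>k. vector [cos (2 * pi * real k / real n), sin (2 * pi * real k / real n)]) ` {..<n}"

definition delta :: "nat \<Rightarrow> real" where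
  "delta r = diameter (eucl_cycle r)"

definition delta2 :: "nat \<Rightarrow> nat \<Rightarrow> real" where
  "delta2 r n = 2 * sin (pi * (1 / real n + real_of_int \<lfloor>real r / 2\<rfloor> / real r))"

end

theory Submission
  imports Defs
begin

text \<open>
  The Euclidean diameter of a subset of the cycle depends only on its combinatorial diameter, so by
  Abel summation the magnitude is determined by the Euler characteristics of the clique complexes
  of the powers \<open>C_n^k\<close>, \<open>2 k < n\<close>. With \<open>m = n - 2 k\<close>, the Euler characteristic is \<open>m\<close>
  if \<open>m\<close> divides \<open>k\<close> and \<open>0\<close> otherwise; in the first case \<open>r = n / m\<close> is an odd divisor of \<open>n\<close>.

  To compute it, sort the cliques by their smallest vertex \<open>a\<close>. The other vertices are near
  (\<open>a + 1, \<dots>, a + k\<close>) or far (\<open>a + n - k, \<dots>, n - 1\<close>), both groups are cliques, and a far vertex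
  conflicts with an interval of \<open>m - 1\<close> near ones. Summing signs over the near vertices first
  cancels everything except the sets of far vertices whose intervals cover all near vertices, and
  the signed number of interval covers satisfies a two-term recursion with an explicit solution.
\<close>

section \<open>Alternating sums over subsets\<close>

text \<open>Adding the empty simplex turns an Euler characteristic into 1 minus a full alternating
  sum, to which sign cancellation applies.\<close>

lemma sum_sign_pred_card:
  assumes "finite C" "\<And>I. I \<in> C \<Longrightarrow> finite I \<and> I \<noteq> {}"
  shows "(\<Sum>I\<in>C. (-1) ^ (card I - 1)) = (1::real) - (\<Sum>I\<in>insert {} C. (-1) ^ card I)"
proof -
  have "(\<Sum>I\<in>C. (-1) ^ (card I - 1) :: real) = (\<Sum>I\<in>C. - ((-1) ^ card I))"
  proof (intro sum.cong refl)
    fix I assume "I \<in> C"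
    then have "card I > 0" using assms(2) by (simp add: card_gt_0_iff)
    then show "(-1) ^ (card I - 1) = (- ((-1) ^ card I) :: real)"
      by (cases "card I") auto
  qed
  moreover have "{} \<notin> C" using assms(2) by blast
  ultimately show ?thesis using assms(1) by (simp add: sum_negf)
qed

lemma alternating_sum_Pow:
  assumes "finite T"
  shows "(\<Sum>N\<in>Pow T. (-1) ^ card N) = (of_bool (T = {}) :: real)"
  using assms
proof (induction T rule: finite_induct)
  case (insert x T)
  have "(\<Sum>N\<in>Pow (insert x T). (-1) ^ card N :: real)
      = (\<Sum>N\<in>Pow T. (-1) ^ card N) + (\<Sum>N\<in>insert x ` Pow T. (-1) ^ card N)"
    unfolding Pow_insert using insert by (intro sum.union_disjoint) auto
  also have "(\<Sum>N\<in>insert x ` Pow T. (-1) ^ card N :: real) = (\<Sum>N\<in>Pow T. (-1) ^ card (insert x N))"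
    using insert by (subst sum.reindex) (auto intro!: inj_onI)
  also have "\<dots> = (\<Sum>N\<in>Pow T. - ((-1) ^ card N))"
  proof (intro sum.cong refl)
    fix N assume "N \<in> Pow T"
    then have "finite N" "x \<notin> N" using insert by (auto intro: rev_finite_subset)
    then show "(-1) ^ card (insert x N) = (- ((-1) ^ card N) :: real)" by simp
  qed
  finally show ?case by (simp add: sum_negf)
qed auto

text \<open>Split on membership of \<open>x\<close>; adding \<open>x\<close> flips the sign. This
  drives both the recursion for covers and the peeling off of smallest clique vertices.\<close>

lemma sum_subset_insert:
  assumes "finite S" "x \<notin> S"
  shows "(\<Sum>I | I \<subseteq> insert x S \<and> Q I. (-1) ^ card I)
       = (\<Sum>I | I \<subseteq> S \<and> Q I. (-1) ^ card I) - (\<Sum>I | I \<subseteq> S \<and> Q (insert x I). (-1) ^ card I :: real)"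
proof -
  have split: "{I. I \<subseteq> insert x S \<and> Q I}
      = {I. I \<subseteq> S \<and> Q I} \<union> insert x ` {I. I \<subseteq> S \<and> Q (insert x I)}" (is "_ = ?A \<union> _ ` ?B")
  proof (intro set_eqI iffI)
    fix I assume I: "I \<in> {I. I \<subseteq> insert x S \<and> Q I}"
    show "I \<in> ?A \<union> insert x ` ?B"
    proof (cases "x \<in> I")
      case True
      then have "I = insert x (I - {x})" by auto
      moreover have "I - {x} \<in> ?B" using I True by (auto simp: insert_absorb)
      ultimately show ?thesis by blast
    qed (use I in auto)
  qed auto
  have fin: "finite ?A" "finite ?B" using assms(1) by auto
  have "(\<Sum>I\<in>insert x ` ?B. (-1) ^ card I :: real) = (\<Sum>I\<in>?B. (-1) ^ card (insert x I))"
    using assms by (subst sum.reindex) (auto intro!: inj_onI)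
  also have "\<dots> = (\<Sum>I\<in>?B. - ((-1) ^ card I))"
  proof (intro sum.cong refl)
    fix I assume "I \<in> ?B"
    then have "finite I" "x \<notin> I" using assms by (auto intro: rev_finite_subset)
    then show "(-1) ^ card (insert x I) = (- ((-1) ^ card I) :: real)" by simp
  qed
  finally have B: "(\<Sum>I\<in>insert x ` ?B. (-1) ^ card I :: real) = - (\<Sum>I\<in>?B. (-1) ^ card I)"
    by (simp add: sum_negf)
  have "(\<Sum>I\<in>?A \<union> insert x ` ?B. (-1) ^ card I :: real)
      = (\<Sum>I\<in>?A. (-1) ^ card I) + (\<Sum>I\<in>insert x ` ?B. (-1) ^ card I)"
    using fin assms by (intro sum.union_disjoint) auto
  then show ?thesis unfolding split B by simp
qed

text \<open>For a fixed part \<open>F\<close> in \<open>S\<close>, the part in \<open>T\<close> is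
  an arbitrary subset of \<open>free F\<close>, so its signed sum is 0 unless every point of
  \<open>T\<close> conflicts with a member of \<open>F\<close>.\<close>

lemma alternating_sum_bipartite:
  assumes "finite S" "finite T" "S \<inter> T = {}"
  shows "(\<Sum>I | I \<subseteq> S \<union> T \<and> (\<forall>s\<in>I \<inter> S. \<forall>t\<in>I \<inter> T. ok s t). (-1) ^ card I)
       = (\<Sum>F | F \<subseteq> S \<and> (\<forall>t\<in>T. \<exists>s\<in>F. \<not> ok s t). (-1) ^ card F :: real)" (is "?L = ?R")
proof -
  define free where "free F = {t \<in> T. \<forall>s\<in>F. ok s t}" for F
  have "?L = (\<Sum>(F, N)\<in>Sigma (Pow S) (\<lambda>F. Pow (free F)). (-1) ^ card F * (-1) ^ card N)"
  proof (rule sum.reindex_bij_witness[where i = "\<lambda>(F, N). F \<union> N" and j = "\<lambda>I. (I \<inter> S, I \<inter> T)"], goal_cases)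
    case (5 I)
    then have "I = (I \<inter> S) \<union> (I \<inter> T)" by auto
    moreover have "card ((I \<inter> S) \<union> (I \<inter> T)) = card (I \<inter> S) + card (I \<inter> T)"
      using assms by (intro card_Un_disjoint) auto
    ultimately have "card I = card (I \<inter> S) + card (I \<inter> T)" by simp
    then show ?case by (simp add: power_add)
  qed (use assms in \<open>auto simp: free_def\<close>)
  also have "\<dots> = (\<Sum>F\<in>Pow S. \<Sum>N\<in>Pow (free F). (-1) ^ card F * (-1) ^ card N)"
    using assms by (subst sum.Sigma) (auto simp: free_def)
  also have "\<dots> = (\<Sum>F\<in>Pow S. (-1) ^ card F * of_bool (free F = {}))"
    using assms by (simp add: sum_distrib_left[symmetric] alternating_sum_Pow free_def)
  also have "\<dots> = ?R"
    using assms by (intro sum.mono_neutral_cong_right) (auto simp: free_def)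
  finally show ?thesis .
qed

section \<open>Signed interval covers\<close>

text \<open>Signed count of covers of the points below \<open>k\<close> by intervals of length
  \<open>w\<close>. An interval is encoded by its left endpoint; the bound \<open>X\<close> on the
  endpoints is there for the recursion.\<close>

definition cover_sum :: "nat \<Rightarrow> nat \<Rightarrow> nat \<Rightarrow> real" where
  "cover_sum w k X = (\<Sum>P | P \<subseteq> {..<X} \<and> (\<forall>y<k. \<exists>x\<in>P. x \<le> y \<and> y < x + w). (-1) ^ card P)"

text \<open>Split on whether an interval starts at \<open>X\<close>. If so, it is the last one and
  must reach \<open>k - 1\<close>; it then covers everything from \<open>X\<close> on, and the
  others have to cover the points below \<open>X\<close>.\<close>

lemma cover_sum_Suc:
  assumes "X < k"
  shows "cover_sum w k (Suc X) = cover_sum w k X - of_bool (k \<le> X + w) * cover_sum w X X"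
proof -
  let ?cov = "\<lambda>k P. \<forall>y<k. \<exists>x\<in>P. x \<le> y \<and> y < x + w"
  have cov: "?cov k (insert X P) \<longleftrightarrow> k \<le> X + w \<and> ?cov X P" if P: "P \<subseteq> {..<X}" for P
  proof
    assume c: "?cov k (insert X P)"
    have "k - 1 < k" using assms by simp
    with c obtain x where "x \<in> insert X P" "k - 1 < x + w" by blast
    then have "k \<le> X + w" using P by auto
    moreover have "?cov X P" using c assms by (metis insertE leD less_trans)
    ultimately show "k \<le> X + w \<and> ?cov X P" ..
  next
    assume c: "k \<le> X + w \<and> ?cov X P"
    show "?cov k (insert X P)"
    proof (intro allI impI)
      fix y assume "y < k"
      then show "\<exists>x\<in>insert X P. x \<le> y \<and> y < x + w"
        using c by (cases "y < X") auto
    qed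
  qed
  have eq: "{P. P \<subseteq> {..<X} \<and> ?cov k (insert X P)}
      = (if k \<le> X + w then {P. P \<subseteq> {..<X} \<and> ?cov X P} else {})"
    using cov by auto
  show ?thesis
    using sum_subset_insert[of "{..<X}" X "?cov k"] unfolding cover_sum_def lessThan_Suc eq
    by simp
qed

text \<open>Induction along the recursion, with \<open>k\<close> general because the recursive term
  has \<open>k = X\<close>. While \<open>k \<le> X + w\<close>, the terms in \<open>X - 1\<close>
  cancel and leave divisibility of \<open>k\<close> against that of \<open>X\<close>.\<close>

lemma cover_sum_closed_form:
  assumes "X \<le> k"
  shows "cover_sum w k X = (if k \<le> X + w
    then of_bool (Suc w dvd k) - of_bool (0 < X \<and> Suc w dvd X - 1) else 0)"
  using assms
proof (induction X arbitrary: k)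
  case 0
  have "{P. P \<subseteq> {..<0::nat} \<and> (\<forall>y<k. \<exists>x\<in>P. x \<le> y \<and> y < x + w)} = (if k = 0 then {{}} else {})"
    by auto
  moreover have "Suc w dvd k \<longleftrightarrow> k = 0" if "k \<le> w"
    using that by (metis dvd_0_right dvd_imp_le le_imp_less_Suc leD neq0_conv)
  ultimately show ?case by (auto simp: cover_sum_def)
next
  case (Suc X)
  \<comment> \<open>At the threshold \<open>k = X + Suc w\<close> the recursion still gives 0; the
    closed form agrees since \<open>k\<close> and \<open>X\<close> are congruent modulo
    \<open>Suc w\<close>.\<close>
  have "Suc w dvd k \<longleftrightarrow> Suc w dvd X" if "\<not> k \<le> X + w" "k \<le> Suc (X + w)"
  proof -
    have "k = X + Suc w" using that by simp
    then show ?thesis by (simp only: dvd_add_left_iff dvd_refl)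
  qed
  with Suc show ?case by (auto simp: cover_sum_Suc)
qed

lemma sum_dvd_window:
  fixes m k :: nat
  assumes "0 < m" "0 < k"
  shows "(\<Sum>Y | Y < k \<and> k \<le> Y + m. of_bool (m dvd Y)) = (1::real)"
proof -
  \<comment> \<open>The largest multiple of \<open>m\<close> below \<open>k\<close>; it is 0 when
    the window is cut off at 0.\<close>
  define q where "q = m * ((k - 1) div m)"
  have mod: "q + (k - 1) mod m = k - 1" "(k - 1) mod m < m"
    using assms by (auto simp: q_def)
  have q: "q < k" "k \<le> q + m" using mod assms by linarith+
  have "m dvd q" by (simp add: q_def)
  have uniq: "Y = q" if Y: "Y < k" "k \<le> Y + m" "m dvd Y" for Y
  proof -
    obtain c where c: "Y = m * c" using Y by auto
    have "m * c \<le> k - 1" "k - 1 < m * Suc c" using Y(1,2) assms(2) unfolding c mult_Suc_right by linarith+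
    then have "(k - 1) div m = c" by (rule div_nat_eqI)
    then show ?thesis unfolding q_def c by (rule arg_cong[where f = "(*) m", symmetric])
  qed
  have "finite {Y. Y < k \<and> k \<le> Y + m}" by (rule finite_subset[of _ "{..<k}"]) auto
  moreover have "(\<Sum>Y | Y < k \<and> k \<le> Y + m. of_bool (m dvd Y))
      = (\<Sum>Y | Y < k \<and> k \<le> Y + m. if Y = q then 1 else (0::real))"
  proof (rule sum.cong[OF refl])
    fix Y assume "Y \<in> {Y. Y < k \<and> k \<le> Y + m}"
    then have "m dvd Y \<longleftrightarrow> Y = q" using uniq \<open>m dvd q\<close> by blast
    then show "of_bool (m dvd Y) = (if Y = q then 1 else (0::real))" by simp
  qed
  ultimately show ?thesis using q by (simp del: sum_of_bool_eq)
qed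

text \<open>With \<open>X = Suc Y\<close>, the closed form is nonzero only for \<open>Y\<close> in a
  window below \<open>k\<close>. The multiples of \<open>Suc w\<close> there contribute -1 by
  \<open>sum_dvd_window\<close>. The other term counts the whole window if \<open>Suc w\<close>
  divides \<open>k\<close>, and then the window has full length since
  \<open>Suc w \<le> k\<close>.\<close>

lemma sum_cover_sum:
  assumes "0 < k"
  shows "(\<Sum>X=1..k. cover_sum w k X) = of_bool (Suc w dvd k) * (1 + real w) - 1"
proof -
  let ?W = "{Y. Y < k \<and> k \<le> Y + Suc w}"
  have "(\<Sum>X=1..k. cover_sum w k X) = (\<Sum>Y<k. cover_sum w k (Suc Y))"
    by (rule sum.reindex_bij_witness[where i = Suc and j = "\<lambda>X. X - 1"]) auto
  also have "\<dots> = (\<Sum>Y\<in>?W. of_bool (Suc w dvd k) - of_bool (Suc w dvd Y))"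
    by (intro sum.mono_neutral_cong_right) (auto simp: cover_sum_closed_form)
  also have "\<dots> = real (card ?W) * of_bool (Suc w dvd k) - 1"
    unfolding sum_subtractf using assms sum_dvd_window[of "Suc w" k]
    by (simp del: sum_of_bool_eq)
  also have "real (card ?W) * of_bool (Suc w dvd k) = of_bool (Suc w dvd k) * (1 + real w)"
  proof (cases "Suc w dvd k")
    case True
    then have "Suc w \<le> k" using assms by (rule dvd_imp_le)
    then have "?W = {k - Suc w..<k}" by auto
    then show ?thesis using \<open>Suc w \<le> k\<close> by simp
  qed simp
  finally show ?thesis .
qed

section \<open>Cliques in powers of a cycle\<close>

text \<open>Subtraction truncates, so \<open>(i - j) + (j - i)\<close> is the absolute difference.\<close>
definition cyc_dist :: "nat \<Rightarrow> nat \<Rightarrow> nat \<Rightarrow> nat" where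
  "cyc_dist n i j = min ((i - j) + (j - i)) (n - ((i - j) + (j - i)))"

definition cyc_clique :: "nat \<Rightarrow> nat \<Rightarrow> nat set \<Rightarrow> bool" where
  "cyc_clique n k I \<longleftrightarrow> (\<forall>i\<in>I. \<forall>j\<in>I. cyc_dist n i j \<le> k)"

text \<open>Removes truncated subtraction, so that linear arithmetic settles adjacency
  questions.\<close>

lemma cyc_dist_le_iff:
  "cyc_dist n i j \<le> k \<longleftrightarrow> (i \<le> j + k \<and> j \<le> i + k) \<or> i + n \<le> j + k \<or> j + n \<le> i + k"
  unfolding cyc_dist_def min_le_iff_disj by linarith

lemma cyc_dist_commute: "cyc_dist n i j = cyc_dist n j i"
  by (simp add: cyc_dist_def add.commute)

lemma cyc_dist_self [simp]: "cyc_dist n i i = 0"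
  by (simp add: cyc_dist_def)

lemma cyc_clique_insert:
  "cyc_clique n k (insert a I) \<longleftrightarrow> cyc_clique n k I \<and> (\<forall>i\<in>I. cyc_dist n a i \<le> k)"
  by (auto simp: cyc_clique_def cyc_dist_commute)

text \<open>For \<open>a < k\<close> there are \<open>k - a\<close> far vertices (\<open>S\<close>),
  within \<open>k\<close> of \<open>a\<close> across 0. Only a far and a near (\<open>T\<close>)
  vertex can fail to be adjacent, so \<open>alternating_sum_bipartite\<close> leaves the far sets
  that block every near vertex, which are interval covers.\<close>

lemma cyc_link_sum_low:
  assumes "2 * k < n" "a < k"
  shows "(\<Sum>I | I \<subseteq> {Suc a..<n} \<and> cyc_clique n k (insert a I). (-1) ^ card I)
       = cover_sum (n - 2 * k - 1) k (k - a)" (is "?L = _")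
proof -
  define S T where "S = {a + n - k..<n}" and "T = {Suc a..a + k}"
  define ok where "ok b p \<longleftrightarrow> cyc_dist n b p \<le> k" for b p
  have "{I. I \<subseteq> {Suc a..<n} \<and> cyc_clique n k (insert a I)}
      = {I. I \<subseteq> S \<union> T \<and> (\<forall>s\<in>I \<inter> S. \<forall>t\<in>I \<inter> T. ok s t)}" (is "?A = ?B")
  proof (intro set_eqI iffI)
    fix I assume I: "I \<in> ?A"
    have "i \<in> S \<union> T" if "i \<in> I" for i
    proof -
      have "Suc a \<le> i" "i < n" "cyc_dist n a i \<le> k" using I that by (auto simp: cyc_clique_def)
      then have "a + n - k \<le> i \<or> i \<le> a + k" unfolding cyc_dist_le_iff by linarith
      then show ?thesis using \<open>Suc a \<le> i\<close> \<open>i < n\<close> by (auto simp: S_def T_def)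
    qed
    then show "I \<in> ?B" using I by (auto simp: ok_def cyc_clique_def)
  next
    fix I assume I: "I \<in> ?B"
    have st: "cyc_dist n s t \<le> k" if "s \<in> I" "s \<in> S" "t \<in> I" "t \<in> T" for s t
      using I that by (auto simp: ok_def)
    have ij: "cyc_dist n i j \<le> k" if "i \<in> I" "j \<in> I" for i j
    proof -
      have "i \<in> S \<union> T" "j \<in> S \<union> T" using I that by auto
      then consider "i \<in> S" "j \<in> S" | "i \<in> T" "j \<in> T" | "i \<in> S" "j \<in> T" | "i \<in> T" "j \<in> S"
        by blast
      then show ?thesis
      proof cases
        case 1
        then have "a + n \<le> i + k" "i < n" "a + n \<le> j + k" "j < n" by (auto simp: S_def)
        then show ?thesis unfolding cyc_dist_le_iff by linarith
      next
        case 2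
        then have "a < i" "i \<le> a + k" "a < j" "j \<le> a + k" by (auto simp: T_def)
        then show ?thesis unfolding cyc_dist_le_iff by linarith
      next
        case 3 then show ?thesis using st that by blast
      next
        case 4 then show ?thesis using st[of j i] that by (simp add: cyc_dist_commute)
      qed
    qed
    have "cyc_dist n a i \<le> k" if "i \<in> I" for i
    proof -
      have "i \<in> S \<union> T" using I that by blast
      then have "a + n \<le> i + k \<or> (a < i \<and> i \<le> a + k)" by (auto simp: S_def T_def)
      then show ?thesis unfolding cyc_dist_le_iff by linarith
    qed
    moreover have "S \<union> T \<subseteq> {Suc a..<n}" using assms by (auto simp: S_def T_def)
    then have "I \<subseteq> {Suc a..<n}" using I by blast
    ultimately show "I \<in> ?A" using ij by (simp add: cyc_clique_insert) (simp add: cyc_clique_def)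
  qed
  then have "?L = (\<Sum>F | F \<subseteq> S \<and> (\<forall>t\<in>T. \<exists>s\<in>F. \<not> ok s t). (-1) ^ card F)"
    using assms by (subst alternating_sum_bipartite[symmetric]) (auto simp: S_def T_def)
  also have "\<dots> = cover_sum (n - 2 * k - 1) k (k - a)"
  proof -
    define c where "c = a + n - k"
    define sh where "sh x = c + x" for x
    have inj: "inj sh" by (auto simp: sh_def inj_def)
    have S: "S = sh ` {..<k - a}"
    proof -
      have "{c + 0..<c + (k - a)} = (+) c ` {0..<k - a}" by (simp add: image_add_atLeastLessThan add.commute)
      moreover have "c + (k - a) = n" using assms by (simp add: c_def)
      ultimately show ?thesis by (simp add: S_def c_def[symmetric] sh_def[abs_def] atLeast0LessThan)
    qed
    have T: "T = (\<lambda>y. Suc (a + y)) ` {..<k}"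
    proof -
      have "t \<in> (\<lambda>y. Suc (a + y)) ` {..<k}" if "t \<in> T" for t
        using that by (intro image_eqI[of _ _ "t - Suc a"]) (auto simp: T_def)
      then show ?thesis by (auto simp: T_def)
    qed
    \<comment> \<open>The two arcs between these vertices have lengths
      \<open>n - k - 1 + x - y\<close> and \<open>k + 1 - x + y\<close>; a conflict means that both
      exceed \<open>k\<close>.\<close>
    have conflict: "\<not> ok (sh x) (Suc (a + y)) \<longleftrightarrow> x \<le> y \<and> y < x + (n - 2 * k - 1)"
      if "x < k - a" "y < k" for x y
    proof -
      obtain m where n: "n = 2 * k + Suc m" using assms(1) less_imp_Suc_add[of "2 * k" n] by auto
      have "sh x = a + k + Suc m + x" "n - 2 * k - 1 = m" by (simp_all add: sh_def c_def n)
      then show ?thesis using that assms(2) unfolding ok_def cyc_dist_le_iff n by auto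
    qed
    show ?thesis
      unfolding cover_sum_def
    \<comment> \<open>Image and preimage under the injective shift are mutually inverse;
      \<open>conflict\<close> matches blocking sets with covers.\<close>
    proof (rule sum.reindex_bij_witness[where i = "(`) sh" and j = "(-`) sh"], goal_cases)
      case (1 F)
      then have "F \<subseteq> range sh" using S by blast
      then show ?case by (simp add: image_vimage_eq Int_absorb2)
    next
      case (2 F)
      then have "F \<subseteq> range sh" using S by blast
      then have F: "sh ` (sh -` F) = F" by (simp add: image_vimage_eq Int_absorb2)
      have "sh -` F \<subseteq> sh -` sh ` {..<k - a}" using 2 S by blast
      then have F': "sh -` F \<subseteq> {..<k - a}" by (simp only: inj_vimage_image_eq[OF inj])
      have "\<exists>x\<in>sh -` F. x \<le> y \<and> y < x + (n - 2 * k - 1)" if "y < k" for y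
      proof -
        have "Suc (a + y) \<in> T" unfolding T using that by blast
        then obtain s where s: "s \<in> F" "\<not> ok s (Suc (a + y))" using 2 by blast
        then obtain x where x: "s = sh x" using \<open>F \<subseteq> range sh\<close> by blast
        then have "x \<in> sh -` F" using s by simp
        moreover from this have "x < k - a" using F' by auto
        ultimately show ?thesis using conflict[of x y] that s x by blast
      qed
      with F' show ?case by simp
    next
      case (3 P)
      then show ?case using inj by (simp add: inj_vimage_image_eq)
    next
      case (4 P)
      have "\<exists>s\<in>sh ` P. \<not> ok s t" if t: "t \<in> T" for t
      proof -
        obtain y where y: "y < k" "t = Suc (a + y)" using t unfolding T by blast
        then obtain x where x: "x \<in> P" "x \<le> y \<and> y < x + (n - 2 * k - 1)" using 4 by blast
        then have "x < k - a" using 4 by auto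
        then show ?thesis using conflict[of x y] x y by blast
      qed
      moreover have "sh ` P \<subseteq> S" unfolding S using 4 by blast
      ultimately show ?case by blast
    next
      case (5 F)
      then have "F \<subseteq> range sh" using S by blast
      then show ?case using inj by (simp add: card_vimage_inj)
    qed
  qed
  finally show ?thesis .
qed

text \<open>Here \<open>a + n - k \<ge> n\<close>, so there are no far vertices, and
  \<open>a\<close> with any set of near ones is a clique. The signs cancel unless there is no near
  vertex above \<open>a\<close> either.\<close>

lemma cyc_link_sum_high:
  assumes "2 * k < n" "k \<le> a" "a < n"
  shows "(\<Sum>I | I \<subseteq> {Suc a..<n} \<and> cyc_clique n k (insert a I). (-1) ^ card I)
       = (of_bool (k = 0 \<or> a = n - 1) :: real)"
proof -
  have "{I. I \<subseteq> {Suc a..<n} \<and> cyc_clique n k (insert a I)} = Pow {Suc a..<min n (Suc (a + k))}"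
    (is "?A = ?B")
  proof (intro set_eqI iffI)
    fix I assume I: "I \<in> ?A"
    have "i < Suc (a + k)" if "i \<in> I" for i
    proof -
      have "Suc a \<le> i" "i < n" "cyc_dist n a i \<le> k" using I that by (auto simp: cyc_clique_def)
      then show ?thesis using assms unfolding cyc_dist_le_iff by linarith
    qed
    with I show "I \<in> ?B" by auto
  next
    fix I assume "I \<in> ?B"
    then have I: "Suc a \<le> i \<and> i < n \<and> i \<le> a + k" if "i \<in> I" for i using that by auto
    have "cyc_dist n i j \<le> k" if "i \<in> insert a I" "j \<in> insert a I" for i j
    proof -
      have "a \<le> i \<and> i \<le> a + k" "a \<le> j \<and> j \<le> a + k" using that I by (auto dest: Suc_leD)
      then show ?thesis unfolding cyc_dist_le_iff by linarith
    qed
    then show "I \<in> ?A" using I by (auto simp: cyc_clique_def)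
  qed
  then show ?thesis using assms by (auto simp: alternating_sum_Pow)
qed

text \<open>Downward induction on \<open>a\<close>: a clique in \<open>{a..<n}\<close> avoids
  \<open>a\<close> or has it as smallest vertex. The 1 comes from the empty clique.\<close>

lemma cyc_clique_sum_tail:
  assumes "a \<le> n"
  shows "(\<Sum>I | I \<subseteq> {a..<n} \<and> cyc_clique n k I. (-1) ^ card I)
       = (1::real) - (\<Sum>b=a..<n. \<Sum>I | I \<subseteq> {Suc b..<n} \<and> cyc_clique n k (insert b I). (-1) ^ card I)"
  using assms
proof (induction a rule: inc_induct)
  case base
  have "{I. I \<subseteq> {n..<n} \<and> cyc_clique n k I} = {{}}" by (auto simp: cyc_clique_def)
  then show ?case by simp
next
  case (step a)
  have "{a..<n} = insert a {Suc a..<n}" using step by auto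
  then show ?case
    using step by (simp add: sum_subset_insert)
qed

lemma cyc_clique_euler_char:
  assumes "2 * k < n"
  shows "(\<Sum>I | I \<noteq> {} \<and> I \<subseteq> {..<n} \<and> cyc_clique n k I. (-1) ^ (card I - 1))
       = (of_bool ((n - 2 * k) dvd k) * real (n - 2 * k))"
proof -
  let ?C = "{I. I \<noteq> {} \<and> I \<subseteq> {..<n} \<and> cyc_clique n k I}"
  define w where "w = n - 2 * k - 1"
  have w: "Suc w = n - 2 * k" using assms by (simp add: w_def)
  define R where "R b = (\<Sum>I | I \<subseteq> {Suc b..<n} \<and> cyc_clique n k (insert b I). (-1) ^ card I :: real)" for b
  have fin: "finite ?C" by (rule finite_subset[of _ "Pow {..<n}"]) auto
  have "(\<Sum>I\<in>?C. (-1) ^ (card I - 1) :: real) = 1 - (\<Sum>I\<in>insert {} ?C. (-1) ^ card I)"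
    using fin by (rule sum_sign_pred_card) (auto dest: finite_subset)
  also have "insert {} ?C = {I. I \<subseteq> {0..<n} \<and> cyc_clique n k I}"
    by (auto simp: cyc_clique_def)
  also have "1 - (\<Sum>I | I \<subseteq> {0..<n} \<and> cyc_clique n k I. (-1) ^ card I) = (\<Sum>b=0..<n. R b)"
    by (simp add: cyc_clique_sum_tail R_def)
  also have "\<dots> = (\<Sum>b=0..<k. R b) + (\<Sum>b=k..<n. R b)"
    using assms by (simp add: sum.atLeastLessThan_concat)
  also have "(\<Sum>b=0..<k. R b) = (\<Sum>b=0..<k. cover_sum w k (k - b))"
    using assms by (intro sum.cong) (auto simp: R_def cyc_link_sum_low w_def)
  also have "\<dots> = (\<Sum>X=1..k. cover_sum w k X)"
    by (rule sum.reindex_bij_witness[where i = "\<lambda>X. k - X" and j = "\<lambda>b. k - b"]) auto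
  also have "(\<Sum>b=k..<n. R b) = (\<Sum>b=k..<n. of_bool (k = 0 \<or> b = n - 1))"
    using assms by (intro sum.cong) (auto simp: R_def cyc_link_sum_high)
  also have "(\<Sum>X=1..k. cover_sum w k X) + (\<Sum>b=k..<n. of_bool (k = 0 \<or> b = n - 1))
      = of_bool ((n - 2 * k) dvd k) * real (n - 2 * k)"
  \<comment> \<open>For \<open>k > 0\<close> the vertices from \<open>k\<close> on contribute only
    1, at \<open>b = n - 1\<close>, which cancels the -1 of \<open>sum_cover_sum\<close>. For
    \<open>k = 0\<close> each of the \<open>n\<close> vertices contributes 1, and \<open>n\<close>
    divides 0.\<close>
  proof (cases "k = 0")
    case False
    have "(\<Sum>b=k..<n. of_bool (b = n - 1)) = (\<Sum>b\<in>{n - 1}. (1::real))"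
      using assms by (intro sum.mono_neutral_cong_right) auto
    moreover have "(\<Sum>X=1..k. cover_sum w k X) = of_bool (Suc w dvd k) * (1 + real w) - 1"
      using False by (intro sum_cover_sum) simp
    ultimately show ?thesis using False by (simp flip: w)
  qed simp
  finally show ?thesis .
qed

section \<open>Diameters of subsets of the cycle\<close>

definition cycle_pt :: "nat \<Rightarrow> nat \<Rightarrow> real ^ 2" where
  "cycle_pt n k = vector [cos (2 * pi * real k / real n), sin (2 * pi * real k / real n)]"

definition chord :: "nat \<Rightarrow> nat \<Rightarrow> real" where
  "chord n k = 2 * sin (pi * real k / real n)"

lemma dist_cycle_pt:
  assumes "i < n" "j < n"
  shows "dist (cycle_pt n i) (cycle_pt n j) = chord n (cyc_dist n i j)"
  using assms
proof (induction i j rule: linorder_wlog)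
  case (sym i j)
  then show ?case by (simp add: dist_commute cyc_dist_def add.commute)
next
  case (le i j)
  define d where "d = j - i"
  have j: "j = i + d" and n: "0 < n" "d \<le> n" using le by (auto simp: d_def)
  define x where "x = pi * real d / real n"
  have x0: "0 \<le> sin x" using n by (intro sin_ge_zero) (auto simp: x_def field_simps)
  define u v where "u = 2 * pi * real i / real n" and "v = 2 * pi * real j / real n"
  have vu: "v - u = 2 * x" using n by (simp add: u_def v_def x_def j field_simps)
  have "(cos u - cos v)\<^sup>2 + (sin u - sin v)\<^sup>2 = 2 - 2 * cos (v - u)"
  proof -
    have "(cos u - cos v)\<^sup>2 + (sin u - sin v)\<^sup>2
        = ((sin u)\<^sup>2 + (cos u)\<^sup>2) + ((sin v)\<^sup>2 + (cos v)\<^sup>2) - 2 * (cos v * cos u + sin v * sin u)"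
      by (simp only: power2_eq_square) algebra
    then show ?thesis by (simp add: cos_diff)
  qed
  also have "\<dots> = (2 * sin x)\<^sup>2"
    unfolding vu by (simp add: cos_double_sin power2_eq_square)
  finally have "dist (cycle_pt n i) (cycle_pt n j) = 2 * sin x"
    using x0 by (simp add: dist_vec_def L2_set_def sum_2 real_sqrt_mult cycle_pt_def dist_real_def u_def v_def)
  \<comment> \<open>Complementary arcs span the same chord, so the minimum in
    \<open>cyc_dist\<close> does not change the length.\<close>
  moreover have "chord n (n - d) = chord n d"
  proof -
    have "pi * real (n - d) / real n = pi - pi * real d / real n"
      using n by (simp add: field_simps of_nat_diff)
    then show ?thesis by (simp add: chord_def)
  qed
  ultimately show ?case
    using le by (simp add: cyc_dist_def d_def min_def chord_def x_def)
qed

text \<open>The bound on \<open>b\<close> keeps both angles in [0, pi/2], where the sine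
  increases.\<close>

lemma chord_mono:
  assumes "a \<le> b" "2 * b \<le> n"
  shows "chord n a \<le> chord n b"
proof (cases "n = 0")
  case False
  have "pi * real a / real n \<le> pi * real b / real n"
    using assms by (intro divide_right_mono mult_left_mono) auto
  moreover have "pi * real b / real n \<le> pi / 2"
  proof -
    have "pi * (real b * 2) \<le> pi * real n" using assms by (intro mult_left_mono) auto
    then show ?thesis using False by (simp add: field_simps)
  qed
  moreover have "- (pi / 2) \<le> pi * real a / real n"
    by (rule order_trans[of _ 0]) auto
  ultimately show ?thesis
    unfolding chord_def by (intro mult_left_mono sin_monotone_2pi_le) auto
qed (use assms in simp)

lemma cyc_dist_le: "2 * cyc_dist n i j \<le> n"
proof -
  have "2 * min x (n - x) \<le> n" for x :: nat by linarith
  then show ?thesis unfolding cyc_dist_def .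
qed

text \<open>Distinct indices have cyclic distance strictly between 0 and \<open>n\<close>, hence a
  chord of positive length. This lets index sets stand for point sets with the same
  cardinality.\<close>

lemma inj_on_cycle_pt: "inj_on (cycle_pt n) {..<n}"
proof (rule inj_onI)
  fix i j assume ij: "i \<in> {..<n}" "j \<in> {..<n}" "cycle_pt n i = cycle_pt n j"
  let ?d = "cyc_dist n i j"
  show "i = j"
  proof (rule ccontr)
    assume "i \<noteq> j"
    then have "0 < ?d" using ij by (auto simp: cyc_dist_def)
    with cyc_dist_le[of n i j] have d: "0 < ?d" "?d < n" by linarith+
    have "0 < sin (pi * real ?d / real n)"
      using d by (intro sin_gt_zero) (auto simp: field_simps)
    moreover have "chord n ?d = 0" using ij dist_cycle_pt[of i n j] by simp
    ultimately show False by (simp add: chord_def)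
  qed
qed

definition cyc_diam :: "nat \<Rightarrow> nat set \<Rightarrow> nat" where
  "cyc_diam n I = Max ((\<lambda>(i, j). cyc_dist n i j) ` (I \<times> I))"

lemma cyc_diam_le_iff:
  assumes "finite I" "I \<noteq> {}"
  shows "cyc_diam n I \<le> k \<longleftrightarrow> cyc_clique n k I"
  using assms by (auto simp: cyc_diam_def cyc_clique_def)

text \<open>Chords grow with cyclic distance up to half the cycle, so a pair of maximal cyclic
  distance also realises the Euclidean diameter.\<close>

lemma diameter_cycle_pt_image:
  assumes "I \<noteq> {}" "I \<subseteq> {..<n}"
  shows "diameter (cycle_pt n ` I) = chord n (cyc_diam n I)"
proof (rule antisym)
  have fin: "finite I" using assms(2) by (rule finite_subset) simp
  have mem: "cyc_diam n I \<in> (\<lambda>(i, j). cyc_dist n i j) ` (I \<times> I)"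
    unfolding cyc_diam_def using fin assms by (intro Max_in) auto
  then obtain i j where ij: "i \<in> I" "j \<in> I" "cyc_diam n I = cyc_dist n i j" by auto
  then have "chord n (cyc_diam n I) = dist (cycle_pt n i) (cycle_pt n j)"
    using assms by (subst dist_cycle_pt) auto
  also have "\<dots> \<le> diameter (cycle_pt n ` I)"
    using fin ij by (intro diameter_bounded_bound) (auto intro: finite_imp_bounded)
  finally show "chord n (cyc_diam n I) \<le> diameter (cycle_pt n ` I)" .
  have "dist (cycle_pt n i') (cycle_pt n j') \<le> chord n (cyc_diam n I)" if "i' \<in> I" "j' \<in> I" for i' j'
  proof -
    have "cyc_clique n (cyc_diam n I) I" using cyc_diam_le_iff[of I n] fin assms by blast
    then have "cyc_dist n i' j' \<le> cyc_diam n I" using that by (auto simp: cyc_clique_def)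
    moreover have "i' < n" "j' < n" using that assms by auto
    ultimately show ?thesis
      using cyc_dist_le[of n i j] by (simp add: dist_cycle_pt chord_mono ij(3))
  qed
  then show "diameter (cycle_pt n ` I) \<le> chord n (cyc_diam n I)"
    using assms by (intro diameter_le) (auto simp: dist_norm)
qed

lemma eucl_cycle_eq: "eucl_cycle n = cycle_pt n ` {..<n}"
  by (simp add: eucl_cycle_def cycle_pt_def)

lemma delta_eq_chord:
  assumes "1 \<le> n"
  shows "delta n = chord n (n div 2)"
proof -
  have ne: "{..<n} \<noteq> {}" using assms by (simp add: lessThan_empty_iff)
  have "cyc_clique n (n div 2) {..<n}" by (auto simp: cyc_clique_def cyc_dist_def)
  then have "cyc_diam n {..<n} \<le> n div 2" using ne by (simp add: cyc_diam_le_iff)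
  \<comment> \<open>The vertices 0 and \<open>n div 2\<close> attain the upper bound.\<close>
  moreover have "cyc_dist n 0 (n div 2) \<le> cyc_diam n {..<n}"
    using cyc_diam_le_iff[of "{..<n}" n "cyc_diam n {..<n}"] ne assms by (auto simp: cyc_clique_def)
  then have "n div 2 \<le> cyc_diam n {..<n}" by (simp add: cyc_dist_def)
  ultimately have "cyc_diam n {..<n} = n div 2" by simp
  then show ?thesis using ne by (simp add: delta_def eucl_cycle_eq diameter_cycle_pt_image)
qed

lemma floor_half_nat: "\<lfloor>real r / 2\<rfloor> = int (r div 2)"
  using floor_divide_of_nat_eq[of r 2, where 'a = real] by simp

section \<open>The Rips magnitude function\<close>

text \<open>Abel summation in a form where \<open>a\<close> enters only through the test
  \<open>a \<le> k\<close>, which becomes the clique condition at scale \<open>k\<close>.\<close>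

lemma of_bool_telescope:
  fixes f :: "nat \<Rightarrow> real"
  assumes "a \<le> h"
  shows "f a = f h + (\<Sum>k<h. of_bool (a \<le> k) * (f k - f (Suc k)))"
proof -
  have "(\<Sum>k<h. of_bool (a \<le> k) * (f k - f (Suc k))) = (\<Sum>k=a..<h. f k - f (Suc k))"
    by (intro sum.mono_neutral_cong_right) auto
  also have "\<dots> = - (\<Sum>k=a..<h. f (Suc k) - f k)" by (simp add: sum_subtractf)
  also have "\<dots> = f a - f h" using assms by (simp add: sum_Suc_diff')
  finally show ?thesis by simp
qed

text \<open>After telescoping and exchanging sums, each difference at scale \<open>k\<close> is
  weighted by the Euler characteristic of the clique complex at that scale.\<close>

lemma rips_magnitude_eucl_cycle:
  assumes "1 \<le> n"
  defines "f \<equiv> \<lambda>t k. exp (- chord n k * t)"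
  shows "rips_magnitude (eucl_cycle n) t = f t (n div 2)
    + (\<Sum>k<n div 2. of_bool ((n - 2 * k) dvd k) * real (n - 2 * k) * (f t k - f t (Suc k)))"
proof -
  define h where "h = n div 2"
  let ?C = "{I. I \<noteq> {} \<and> I \<subseteq> {..<n}}"
  let ?s = "\<lambda>I::nat set. (-1) ^ (card I - 1) :: real"
  have bij: "bij_betw ((`) (cycle_pt n)) ?C {A. A \<noteq> {} \<and> A \<subseteq> eucl_cycle n}"
  proof (rule bij_betw_imageI)
    show "inj_on ((`) (cycle_pt n)) ?C"
      using inj_on_image_Pow[OF inj_on_cycle_pt] by (rule inj_on_subset) auto
    show "(`) (cycle_pt n) ` ?C = {A. A \<noteq> {} \<and> A \<subseteq> eucl_cycle n}"
    proof (intro set_eqI iffI)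
      fix A assume "A \<in> {A. A \<noteq> {} \<and> A \<subseteq> eucl_cycle n}"
      then obtain I where "I \<subseteq> {..<n}" "A = cycle_pt n ` I" "A \<noteq> {}"
        unfolding eucl_cycle_eq by (auto simp: subset_image_iff)
      then show "A \<in> (`) (cycle_pt n) ` ?C" by blast
    qed (auto simp: eucl_cycle_eq)
  qed
  \<comment> \<open>No cyclic distance exceeds \<open>n div 2\<close>, so the telescoping can end at
    \<open>h\<close> for every set.\<close>
  have clique_h: "cyc_clique n h I" if "I \<in> ?C" for I
    using that by (auto simp: cyc_clique_def cyc_dist_def h_def)
  have le_iff: "cyc_diam n I \<le> k \<longleftrightarrow> cyc_clique n k I" if "I \<in> ?C" for I k
    using that by (intro cyc_diam_le_iff) (auto dest: finite_subset)
  have "rips_magnitude (eucl_cycle n) t = (\<Sum>I\<in>?C. ?s I * f t (cyc_diam n I))"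
    unfolding rips_magnitude_def
  proof (subst sum.reindex_bij_betw[OF bij, symmetric], intro sum.cong refl)
    fix I assume I: "I \<in> ?C"
    then have "card (cycle_pt n ` I) = card I"
      using inj_on_cycle_pt by (intro card_image) (auto intro: inj_on_subset)
    then show "(-1) ^ (card (cycle_pt n ` I) - 1) * exp (- diameter (cycle_pt n ` I) * t)
        = ?s I * f t (cyc_diam n I)"
      using I by (simp add: diameter_cycle_pt_image f_def)
  qed
  also have "\<dots> = (\<Sum>I\<in>?C. ?s I * f t h + (\<Sum>k<h. of_bool (cyc_clique n k I) * ?s I * (f t k - f t (Suc k))))"
  proof (intro sum.cong refl)
    fix I assume I: "I \<in> ?C"
    have "cyc_diam n I \<le> h" using clique_h[OF I] le_iff[OF I] by simp
    then have "f t (cyc_diam n I) = f t h + (\<Sum>k<h. of_bool (cyc_clique n k I) * (f t k - f t (Suc k)))"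
      using of_bool_telescope[of "cyc_diam n I" h "f t"] le_iff[OF I] by simp
    then show "?s I * f t (cyc_diam n I)
        = ?s I * f t h + (\<Sum>k<h. of_bool (cyc_clique n k I) * ?s I * (f t k - f t (Suc k)))"
      by (simp add: distrib_left sum_distrib_left mult_ac)
  qed
  also have "\<dots> = (\<Sum>I\<in>?C. ?s I) * f t h
      + (\<Sum>k<h. (\<Sum>I\<in>?C. of_bool (cyc_clique n k I) * ?s I) * (f t k - f t (Suc k)))"
    unfolding sum.distrib sum_distrib_right by (subst sum.swap[of _ "{..<h}"]) (rule refl)
  \<comment> \<open>At scale \<open>h\<close> the complex is a full simplex on
    \<open>n \<ge> 1\<close> vertices.\<close>
  also have "(\<Sum>I\<in>?C. ?s I) = 1"
  proof -
    have fin: "finite ?C" by (rule finite_subset[of _ "Pow {..<n}"]) auto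
    then have "(\<Sum>I\<in>?C. ?s I) = 1 - (\<Sum>I\<in>insert {} ?C. (-1) ^ card I)"
      by (rule sum_sign_pred_card) (auto dest: finite_subset)
    also have "insert {} ?C = Pow {..<n}" by auto
    also have "1 - (\<Sum>I\<in>Pow {..<n}. (-1) ^ card I) = (1::real)"
      using assms by (subst alternating_sum_Pow) (auto simp: lessThan_empty_iff)
    finally show ?thesis .
  qed
  also have "(\<Sum>k<h. (\<Sum>I\<in>?C. of_bool (cyc_clique n k I) * ?s I) * (f t k - f t (Suc k)))
      = (\<Sum>k<h. of_bool ((n - 2 * k) dvd k) * real (n - 2 * k) * (f t k - f t (Suc k)))"
  proof (intro sum.cong refl)
    fix k assume "k \<in> {..<h}"
    then have k: "2 * k < n" by (auto simp: h_def)
    have "(\<Sum>I\<in>?C. of_bool (cyc_clique n k I) * ?s I)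
        = (\<Sum>I | I \<noteq> {} \<and> I \<subseteq> {..<n} \<and> cyc_clique n k I. ?s I)"
      by (intro sum.mono_neutral_cong_right finite_subset[of ?C "Pow {..<n}"]) auto
    with cyc_clique_euler_char[OF k]
    show "(\<Sum>I\<in>?C. of_bool (cyc_clique n k I) * ?s I) * (f t k - f t (Suc k))
        = of_bool ((n - 2 * k) dvd k) * real (n - 2 * k) * (f t k - f t (Suc k))" by simp
  qed
  finally show ?thesis by (simp add: h_def)
qed

text \<open>If \<open>m = n - 2 * k\<close> divides \<open>k = m * i\<close>, then
  \<open>n = m * (2 * i + 1)\<close>, so \<open>k\<close> corresponds to the odd divisor
  \<open>r = 2 * i + 1\<close> with cofactor \<open>m\<close>. Excluding \<open>r = n\<close> means
  excluding \<open>m = 1\<close>.\<close>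

lemma sum_odd_divisors:
  fixes g :: "nat \<Rightarrow> real"
  assumes "1 \<le> n"
  shows "(\<Sum>k<n div 2. of_bool ((n - 2 * k) dvd k) * g k)
       = (\<Sum>r | r dvd n \<and> odd r \<and> r \<noteq> n. g ((n div r) * (r div 2)))"
proof -
  let ?K = "{k. k < n div 2 \<and> (n - 2 * k) dvd k}"
  let ?R = "{r. r dvd n \<and> odd r \<and> r \<noteq> n}"
  have "(\<Sum>k<n div 2. of_bool ((n - 2 * k) dvd k) * g k) = (\<Sum>k\<in>?K. g k)"
    by (intro sum.mono_neutral_cong_right) auto
  also have "\<dots> = (\<Sum>r\<in>?R. g ((n div r) * (r div 2)))"
  proof (rule sum.reindex_bij_witness[where i = "\<lambda>r. (n div r) * (r div 2)" and j = "\<lambda>k. n div (n - 2 * k)"])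
    fix k assume k: "k \<in> ?K"
    define m where "m = n - 2 * k"
    obtain i where i: "k = m * i" using k by (auto simp: m_def)
    \<comment> \<open>\<open>k < n div 2\<close> gives \<open>2 \<le> m\<close>, which later yields
      \<open>r \<noteq> n\<close>.\<close>
    have "2 \<le> m" "n = m + 2 * k" using k by (auto simp: m_def)
    then have m: "2 \<le> m" "n = m * (2 * i + 1)" unfolding i by (simp_all add: algebra_simps)
    have r: "n div (n - 2 * k) = 2 * i + 1"
      unfolding m_def[symmetric] unfolding m(2) using m(1) by (intro nonzero_mult_div_cancel_left) simp
    show "(n div (n div (n - 2 * k))) * (n div (n - 2 * k) div 2) = k"
    proof -
      have "n div (2 * i + 1) = m" unfolding m(2) by (rule nonzero_mult_div_cancel_right) simp
      moreover have "(2 * i + 1) div 2 = i" by simp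
      ultimately show ?thesis unfolding r unfolding i by (simp only:)
    qed
    then show "g ((n div (n div (n - 2 * k))) * (n div (n - 2 * k) div 2)) = g k" by simp
    show "n div (n - 2 * k) \<in> ?R"
    proof -
      have "2 * (2 * i + 1) \<le> n" unfolding m(2) using m(1) by (rule mult_right_mono) simp
      then have "2 * i + 1 \<noteq> n" by simp
      moreover have "2 * i + 1 dvd n" unfolding m(2) by (rule dvd_triv_right)
      ultimately show ?thesis unfolding r by simp
    qed
  next
    fix r assume r: "r \<in> ?R"
    define m i where "m = n div r" and "i = r div 2"
    have ri: "r = 2 * i + 1" using r by (auto simp: i_def)
    have n: "n = m * r" using r by (auto simp: m_def)
    have m: "2 \<le> m"
    proof -
      have "m \<noteq> 0" "m \<noteq> 1" using n r assms by auto
      then show ?thesis by simp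
    qed
    have nk: "n - 2 * (m * i) = m" by (simp add: n ri algebra_simps)
    show "n div (n - 2 * (n div r * (r div 2))) = r"
      unfolding m_def[symmetric] i_def[symmetric] nk using m n by simp
    have "2 * (m * i + 1) \<le> n" using m by (simp add: n ri algebra_simps)
    then show "n div r * (r div 2) \<in> ?K"
      unfolding m_def[symmetric] i_def[symmetric] using nk by auto
  qed
  finally show ?thesis .
qed

theorem corollary8p3:
  fixes n :: nat
  assumes "n \<ge> 1"
  shows "(\<forall>r::nat. r \<ge> 1 \<longrightarrow> delta r = 2 * sin (pi * (real_of_int \<lfloor>real r / 2\<rfloor> / real r)))
    \<and> (\<forall>t::real. t > 0 \<longrightarrow>
        rips_magnitude (eucl_cycle n) t =
          (\<Sum>r | r dvd n \<and> odd r \<and> r \<noteq> n.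
             real n / real r * (exp (- delta r * t) - exp (- delta2 r n * t)))
          + exp (- delta n * t))"
proof (intro conjI allI impI)
  fix r :: nat assume "r \<ge> 1"
  then show "delta r = 2 * sin (pi * (real_of_int \<lfloor>real r / 2\<rfloor> / real r))"
    by (simp add: delta_eq_chord chord_def floor_half_nat)
next
  fix t :: real
  define g where "g k = real (n - 2 * k) * (exp (- chord n k * t) - exp (- chord n (Suc k) * t))" for k
  have g: "g (n div r * (r div 2)) = real n / real r * (exp (- delta r * t) - exp (- delta2 r n * t))"
    if r: "r dvd n" "odd r" for r
  proof -
    define m i where "m = n div r" and "i = r div 2"
    have ri: "r = 2 * i + 1" using r by (auto simp: i_def)
    have n: "n = m * r" using r by (auto simp: m_def)
    have m: "0 < m" using n assms by auto
    have nk: "n - 2 * (m * i) = m" by (simp add: n ri algebra_simps)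
    \<comment> \<open>The scale \<open>k = m * i\<close> spans the same angle in the
      \<open>n\<close>-cycle as \<open>i = r div 2\<close> steps in the \<open>r\<close>-cycle,
      whose chord is the diameter \<open>delta r\<close>.\<close>
    have quot: "real (m * i) / real n = real i / real r" using m by (simp add: n)
    have "chord n (m * i) = delta r"
      using quot ri by (simp add: delta_eq_chord chord_def i_def[symmetric] times_divide_eq_right[symmetric]
          del: times_divide_eq_right of_nat_mult)
    \<comment> \<open>One further step in the \<open>n\<close>-cycle adds the summand
      \<open>1 / n\<close> of \<open>delta2\<close>.\<close>
    moreover have "chord n (Suc (m * i)) = delta2 r n"
    proof -
      have "real (Suc (m * i)) / real n = 1 / real n + real i / real r"
        using quot by (simp add: add_divide_distrib)
      then show ?thesis
        by (simp add: delta2_def chord_def floor_half_nat i_def[symmetric] times_divide_eq_right[symmetric]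
          del: times_divide_eq_right of_nat_mult of_nat_Suc)
    qed
    moreover have "real m = real n / real r"
      using ri by (simp only: n of_nat_mult) (simp del: of_nat_Suc)
    ultimately show ?thesis by (simp add: g_def m_def[symmetric] i_def[symmetric] nk)
  qed
  have "rips_magnitude (eucl_cycle n) t
      = exp (- delta n * t) + (\<Sum>k<n div 2. of_bool ((n - 2 * k) dvd k) * g k)"
    using assms by (simp add: rips_magnitude_eucl_cycle delta_eq_chord g_def mult.assoc)
  also have "\<dots> = (\<Sum>r | r dvd n \<and> odd r \<and> r \<noteq> n.
             real n / real r * (exp (- delta r * t) - exp (- delta2 r n * t))) + exp (- delta n * t)"
    unfolding sum_odd_divisors[OF assms] using g by simp
  finally show "rips_magnitude (eucl_cycle n) t = (\<Sum>r | r dvd n \<and> odd r \<and> r \<noteq> n.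
             real n / real r * (exp (- delta r * t) - exp (- delta2 r n * t))) + exp (- delta n * t)" .
qed

end
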